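(* There is an absolute constant $C>0$ such that the following holds. Let $\bar L_c>0$, $R_0\ge1$, $l\ge1$, $c\ge1$ and $0<\epsilon\le\bar L_cR_0^2/100$ be given. For every sufficiently large problem dimension, namely $n>2\lceil R_0\sqrt{\bar L_c/\epsilon}\rceil$, there exists a problem $\min_{x\in X}\{f(x)+u(x)\}$ subject to $g(x)\le0$ in $\mathbb R^n$, with $\alpha=0$, $\|\lambda^*\|=l$, $\|x^0-x^*\|\le R_0$, $f$ affine, and aggregate smoothness constant $L(\Lambda_c)\le\bar L_c$, such that every first-order method in the class $\mathcal F$ (defined in the context) started from $x^0$ requires at least $$C\,\frac{\sqrt{\bar L_c}\,R_0}{\sqrt\epsilon}$$ queries to the first-order oracle to find an $(\epsilon;\epsilon/c)$-optimal solution.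
   Context: Problem class: $\min_{x\in X}\{F(x)=f(x)+u(x)\}$ subject to $g(x)\le0$ in $\mathbb R^n$, with $f$ and $g=(g_1,\dots,g_m)$ convex with Lipschitz continuous gradients, $u(x)=\frac\alpha2\|x\|^2$ (so $u=0$ when $\alpha=0$), and $X=B(0;R_X)$ a Euclidean ball centered at the origin with radius $R_X\in(0,\infty]$. $x^*$ is an optimal solution and $\lambda^*\in\mathbb R^m_+$ a corresponding KKT multiplier. $L_\lambda$ denotes a Lipschitz constant of the gradient of $f+\sum_i\lambda_ig_i$, $L(\Lambda)=\sup_{\lambda\in\Lambda}L_\lambda$, and $\Lambda_r=\{0\}\cup\{\lambda^*+\lambda:\lambda\in\mathbb R^m_+,\|\lambda\|\le r\}$. A point $x$ is $(\epsilon;\epsilon/c)$-optimal if $F(x)-F(x^* )\le\epsilon$ and $\|[g(x)]_+\|\le\epsilon/c$. First-order oracle: queried at $y$ it returns $f(y),g(y),\nabla f(y),\nabla g(y)$. Class $\mathcal F$: first-order methods that start from memory $\mathcal M_0=\{x^0\}$ and, at the $t$-th oracle query, made at some $y\in\operatorname{span}(\mathcal M_{t-1})$, produce a (finite) memory of reachable points $$\mathcal M_t\subset\Big\{x+\eta_t\nabla f(y)+\sum_{i=1}^m\tau_{i,t}\nabla g_i(y):\ x,y\in\operatorname{span}(\mathcal M_{t-1}),\ \eta_t,\tau_{i,t}\in\mathbb R\Big\}.$$ A solution found after $t$ queries is an element of $\mathcal M_t$. *)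

theory Defs
  imports "HOL-Analysis.Analysis"
begin

text \<open>
  The dimension is quantified inside the theorem, after the absolute constant, so \<open>\<real>\<^sup>n\<close> cannot be
  a type indexed by its dimension. The type \<open>fvec\<close> of finitely supported real sequences is an inner
  product space containing every \<open>\<real>\<^sup>n\<close> as the subspace of sequences supported on \<open>{..<n}\<close>.
  (The library norm on finitely supported functions, in Finite_Function_Topology, is the 1-norm,
  hence the new type.)
\<close>

typedef fvec = "{x :: nat \<Rightarrow> real. finite {i. x i \<noteq> 0}}"
  morphisms coord Abs_fvec
  by (rule exI[of _ "\<lambda>_. 0"]) simp

setup_lifting type_definition_fvec

lemma fvec_eq_iff: "x = y \<longleftrightarrow> (\<forall>i. coord x i = coord y i)"
  by (auto simp: coord_inject[symmetric] fun_eq_iff)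

lemma finite_support: "finite {i. coord x i \<noteq> 0}"
  using coord[of x] by simp

instantiation fvec :: real_vector
begin

lift_definition zero_fvec :: fvec is "\<lambda>_. 0"
  by simp

lift_definition plus_fvec :: "fvec \<Rightarrow> fvec \<Rightarrow> fvec" is "\<lambda>x y i. x i + y i"
  by (rule finite_subset[rotated], erule (1) finite_UnI) auto

lift_definition uminus_fvec :: "fvec \<Rightarrow> fvec" is "\<lambda>x i. - x i"
  by simp

lift_definition minus_fvec :: "fvec \<Rightarrow> fvec \<Rightarrow> fvec" is "\<lambda>x y i. x i - y i"
  by (rule finite_subset[rotated], erule (1) finite_UnI) auto

lift_definition scaleR_fvec :: "real \<Rightarrow> fvec \<Rightarrow> fvec" is "\<lambda>r x i. r * x i"
  by (erule finite_subset[rotated]) auto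

instance
  by standard (transfer; auto simp: algebra_simps)+

end

lemma coord_zero [simp]: "coord 0 i = 0"
  by (simp add: zero_fvec.rep_eq)

lemma coord_plus [simp]: "coord (x + y) i = coord x i + coord y i"
  by (simp add: plus_fvec.rep_eq)

lemma coord_uminus [simp]: "coord (- x) i = - coord x i"
  by (simp add: uminus_fvec.rep_eq)

lemma coord_minus [simp]: "coord (x - y) i = coord x i - coord y i"
  by (simp add: minus_fvec.rep_eq)

lemma coord_scaleR [simp]: "coord (r *\<^sub>R x) i = r * coord x i"
  by (simp add: scaleR_fvec.rep_eq)

instantiation fvec :: real_inner
begin

definition inner_fvec :: "fvec \<Rightarrow> fvec \<Rightarrow> real"
  where "inner_fvec x y = (\<Sum>i | coord x i \<noteq> 0. coord x i * coord y i)"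

definition norm_fvec :: "fvec \<Rightarrow> real"
  where "norm_fvec x = sqrt (inner x x)"

definition dist_fvec :: "fvec \<Rightarrow> fvec \<Rightarrow> real"
  where "dist_fvec x y = norm (x - y)"

definition sgn_fvec :: "fvec \<Rightarrow> fvec"
  where "sgn_fvec x = x /\<^sub>R norm x"

definition uniformity_fvec :: "(fvec \<times> fvec) filter"
  where "uniformity_fvec = (INF e\<in>{0<..}. principal {(x, y). dist x y < e})"

definition open_fvec :: "fvec set \<Rightarrow> bool"
  where "open_fvec U \<longleftrightarrow> (\<forall>x\<in>U. \<forall>\<^sub>F (x', y) in uniformity. x' = x \<longrightarrow> y \<in> U)"

lemma inner_fvec_superset:
  assumes "finite A" "{i. coord x i \<noteq> 0} \<subseteq> A"
  shows "inner x y = (\<Sum>i\<in>A. coord x i * coord y i)"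
  unfolding inner_fvec_def using assms by (intro sum.mono_neutral_left) auto

instance
proof
  fix x y z :: fvec and r :: real
  let ?A = "{i. coord x i \<noteq> 0} \<union> {i. coord y i \<noteq> 0}"
  have A: "finite ?A" by (simp add: finite_support)
  show "inner x y = inner y x"
    by (subst (1 2) inner_fvec_superset[OF A]) (auto simp: mult.commute)
  have "inner (x + y) z = (\<Sum>i\<in>?A. coord (x + y) i * coord z i)"
    by (rule inner_fvec_superset[OF A]) auto
  also have "\<dots> = (\<Sum>i\<in>?A. coord x i * coord z i) + (\<Sum>i\<in>?A. coord y i * coord z i)"
    by (simp add: distrib_right sum.distrib)
  also have "\<dots> = inner x z + inner y z"
    by (subst (1 2) inner_fvec_superset[OF A]) auto
  finally show "inner (x + y) z = inner x z + inner y z" .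
  show "inner (r *\<^sub>R x) y = r * inner x y"
    by (subst (1 2) inner_fvec_superset[OF A]) (auto simp: sum_distrib_left mult.assoc)
  show "0 \<le> inner x x"
    by (simp add: inner_fvec_def sum_nonneg)
  show "inner x x = 0 \<longleftrightarrow> x = 0"
    by (auto simp: inner_fvec_def sum_nonneg_eq_0_iff finite_support fvec_eq_iff)
qed (simp_all add: norm_fvec_def dist_fvec_def sgn_fvec_def uniformity_fvec_def open_fvec_def)

end

definition Rn :: "nat \<Rightarrow> fvec set"
  where "Rn n = {x. \<forall>i\<ge>n. coord x i = 0}"

text \<open>The derivative within \<open>Rn n\<close> determines \<open>v\<close> only because \<open>v\<close> is required to lie in \<open>Rn n\<close>.\<close>

definition has_grad :: "nat \<Rightarrow> (fvec \<Rightarrow> real) \<Rightarrow> fvec \<Rightarrow> fvec \<Rightarrow> bool"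
  where "has_grad n h x v \<longleftrightarrow>
    v \<in> Rn n \<and> (h has_derivative (\<lambda>d. inner v d)) (at x within Rn n)"

definition grad :: "nat \<Rightarrow> (fvec \<Rightarrow> real) \<Rightarrow> fvec \<Rightarrow> fvec"
  where "grad n h x = (THE v. has_grad n h x v)"

definition smooth_convex :: "nat \<Rightarrow> (fvec \<Rightarrow> real) \<Rightarrow> bool"
  where "smooth_convex n h \<longleftrightarrow>
    convex_on (Rn n) h \<and> (\<forall>x\<in>Rn n. \<exists>v. has_grad n h x v) \<and>
    (\<exists>L. L-lipschitz_on (Rn n) (grad n h))"

definition affine_fun :: "nat \<Rightarrow> (fvec \<Rightarrow> real) \<Rightarrow> bool"
  where "affine_fun n h \<longleftrightarrow> (\<exists>a\<in>Rn n. \<exists>b. \<forall>x\<in>Rn n. h x = inner a x + b)"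

record problem =
  num :: nat
  alpha :: real
  radius :: ereal
  obj :: "fvec \<Rightarrow> real"
  con :: "nat \<Rightarrow> fvec \<Rightarrow> real"

definition problem :: "nat \<Rightarrow> problem \<Rightarrow> bool"
  where "problem n P \<longleftrightarrow>
    0 \<le> alpha P \<and> 0 < radius P \<and>
    smooth_convex n (obj P) \<and> (\<forall>i<num P. smooth_convex n (con P i))"

definition domain :: "nat \<Rightarrow> problem \<Rightarrow> fvec set"
  where "domain n P = {x \<in> Rn n. ereal (norm x) \<le> radius P}"

definition total_obj :: "problem \<Rightarrow> fvec \<Rightarrow> real"
  where "total_obj P x = obj P x + alpha P / 2 * (norm x)\<^sup>2"

definition optimal_solution :: "nat \<Rightarrow> problem \<Rightarrow> fvec \<Rightarrow> bool"
  where "optimal_solution n P xs \<longleftrightarrow>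
    xs \<in> domain n P \<and> (\<forall>i<num P. con P i xs \<le> 0) \<and>
    (\<forall>x\<in>domain n P. (\<forall>i<num P. con P i x \<le> 0) \<longrightarrow> total_obj P xs \<le> total_obj P x)"

text \<open>
  The variational inequality says that minus the gradient of the Lagrangian lies in the normal cone
  of the domain at \<open>xs\<close>.
\<close>

definition kkt_multiplier :: "nat \<Rightarrow> problem \<Rightarrow> fvec \<Rightarrow> fvec \<Rightarrow> bool"
  where "kkt_multiplier n P xs ls \<longleftrightarrow>
    ls \<in> Rn (num P) \<and>
    (\<forall>i<num P. 0 \<le> coord ls i \<and> coord ls i * con P i xs = 0) \<and>
    (\<forall>x\<in>domain n P.
       0 \<le> inner (grad n (total_obj P) xs + (\<Sum>i<num P. coord ls i *\<^sub>R grad n (con P i) xs)) (x - xs))"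

text \<open>
  The Lipschitz constant of a gradient is taken to be the least one (infinite if there is none);
  the aggregate smoothness constant is the supremum of these constants over a set of multipliers.
\<close>

definition grad_lipschitz :: "nat \<Rightarrow> (fvec \<Rightarrow> real) \<Rightarrow> ereal"
  where "grad_lipschitz n h = Inf {ereal L |L. L-lipschitz_on (Rn n) (grad n h)}"

definition aggregate_smoothness :: "nat \<Rightarrow> problem \<Rightarrow> fvec set \<Rightarrow> ereal"
  where "aggregate_smoothness n P \<Lambda> =
    (SUP l\<in>\<Lambda>. grad_lipschitz n (\<lambda>x. obj P x + (\<Sum>i<num P. coord l i * con P i x)))"

definition multiplier_set :: "problem \<Rightarrow> fvec \<Rightarrow> real \<Rightarrow> fvec set"
  where "multiplier_set P ls r =
    {0} \<union> {ls + l |l. l \<in> Rn (num P) \<and> (\<forall>i<num P. 0 \<le> coord l i) \<and> norm l \<le> r}"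

definition approx_optimal :: "problem \<Rightarrow> fvec \<Rightarrow> real \<Rightarrow> real \<Rightarrow> fvec \<Rightarrow> bool"
  where "approx_optimal P xs e d x \<longleftrightarrow>
    total_obj P x - total_obj P xs \<le> e \<and> L2_set (\<lambda>i. max 0 (con P i x)) {..<num P} \<le> d"

text \<open>
  A first-order scheme enters only through the memories \<open>M t\<close> it produces on the given problem,
  \<open>t\<close> being the number of oracle queries made. A scheme that stops is covered by repeating its last
  memory. The query point \<open>y\<close> and the coefficients may differ between elements of \<open>M (Suc t)\<close>; runs
  with a single query point per step are a special case.
\<close>

definition first_order_run :: "nat \<Rightarrow> problem \<Rightarrow> fvec \<Rightarrow> (nat \<Rightarrow> fvec set) \<Rightarrow> bool"
  where "first_order_run n P x0 M \<longleftrightarrow>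
    M 0 = {x0} \<and>
    (\<forall>t. finite (M (Suc t)) \<and>
         M (Suc t) \<subseteq>
           {x + \<eta> *\<^sub>R grad n (obj P) y + (\<Sum>i<num P. \<tau> i *\<^sub>R grad n (con P i) y) | x y \<eta> \<tau>.
              x \<in> span (M t) \<and> y \<in> span (M t)})"

end

theory Submission
  imports Defs
begin

text \<open>
  The hard problem puts all the difficulty into feasibility. The objective is the constant \<open>0\<close>, so
  every feasible point is optimal and only a violated constraint can keep a point from being
  approximately optimal. There are two constraints. The first one is identically \<open>0\<close>; it is always
  active and has zero gradient, so its multiplier may be given the prescribed norm \<open>l\<close> although it
  contributes nothing to the Lagrangian. The second one is the multiple by \<open>L / (8 * c)\<close> of
  Nesterov's chain \<open>(x\<^sub>0 - b)\<^sup>2 + (x\<^sub>1 - x\<^sub>0)\<^sup>2 + \<dots> + (x\<^sub>m - x\<^sub>m\<^sub>-\<^sub>1)\<^sup>2\<close> in \<open>N = m + 1\<close>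
  coordinates, which is nonnegative and vanishes at the optimal solution \<open>(b, \<dots>, b)\<close>. Its own
  multiplier is \<open>0\<close>, so over the shifted multipliers it is weighted by at most \<open>c\<close>; since the
  chain has an 8-Lipschitz gradient (\<open>chain_edges_bessel\<close>, \<open>grad_lsq_lipschitz\<close>), the aggregate
  smoothness constant is at most \<open>L\<close>, however \<open>l\<close> and \<open>c\<close> compare. Placing \<open>l\<close> on the difficult
  constraint instead would raise this weight to \<open>l + c\<close> and cost a factor depending on \<open>l / c\<close>.

  The gradient of the chain at a point supported on the first \<open>t\<close> coordinates is supported on the
  first \<open>t + 1\<close> ones, so started at \<open>0\<close> a method needs \<open>N\<close> queries before the last coordinate of
  the chain can be nonzero (\<open>chain_run_support\<close>). Until then the \<open>N\<close> increments along the chain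
  must descend from \<open>b\<close> to \<open>0\<close>, which by Cauchy-Schwarz makes the chain at least \<open>b\<^sup>2 / N\<close>
  (\<open>chain_lower_bound\<close>). The choice \<open>b = R0 / sqrt N\<close> makes the distance to the solution exactly
  \<open>R0\<close> and the violation at least \<open>L * R0\<^sup>2 / (8 * c * N\<^sup>2)\<close>. This exceeds \<open>\<epsilon> / c\<close> for \<open>N\<close> up to a
  constant times \<open>R0 * sqrt (L / \<epsilon>)\<close>.
\<close>

section \<open>Coordinates and coordinate subspaces\<close>

lift_definition unit :: "nat \<Rightarrow> fvec" is "\<lambda>j i. if i = j then 1 else 0"
  by simp

lemma coord_unit [simp]: "coord (unit j) i = (if i = j then 1 else 0)"
  by (simp add: unit.rep_eq)

lemma inner_unit [simp]: "inner (unit j) x = coord x j"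
  by (subst inner_fvec_superset[of "{j}"]) auto

lemma coord_sum [simp]: "coord (sum f A) i = (\<Sum>j\<in>A. coord (f j) i)"
  by (induction A rule: infinite_finite_induct) auto

lemma inner_Rn: "x \<in> Rn n \<Longrightarrow> inner x y = (\<Sum>i<n. coord x i * coord y i)"
  by (rule inner_fvec_superset) (auto simp: Rn_def not_less[symmetric])

lemma norm_Rn: "x \<in> Rn n \<Longrightarrow> norm x = L2_set (coord x) {..<n}"
  by (simp add: norm_eq_sqrt_inner inner_Rn L2_set_def power2_eq_square)

lemma sum_coord_le_norm: "(\<Sum>i<n. (coord x i)\<^sup>2) \<le> (norm x)\<^sup>2"
proof -
  let ?A = "{i. coord x i \<noteq> 0} \<union> {..<n}"
  have "(\<Sum>i<n. (coord x i)\<^sup>2) \<le> (\<Sum>i\<in>?A. (coord x i)\<^sup>2)"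
    by (rule sum_mono2) (auto simp: finite_support)
  also have "\<dots> = inner x x"
    by (subst inner_fvec_superset[of ?A]) (auto simp: finite_support power2_eq_square)
  finally show ?thesis by (simp add: power2_norm_eq_inner)
qed

lemma abs_coord_le_norm: "\<bar>coord x i\<bar> \<le> norm x"
proof -
  have "(coord x i)\<^sup>2 \<le> (\<Sum>j<Suc i. (coord x j)\<^sup>2)"
    by (simp add: sum_nonneg)
  also have "\<dots> \<le> (norm x)\<^sup>2" by (rule sum_coord_le_norm)
  finally show ?thesis by (metis abs_le_square_iff abs_norm_cancel)
qed

lemma subspace_Rn [simp]: "subspace (Rn n)"
  by (auto simp: subspace_def Rn_def)

lemma convex_Rn [simp]: "convex (Rn n)"
  by (rule subspace_imp_convex) simp

lemma Rn_mono: "m \<le> n \<Longrightarrow> Rn m \<subseteq> Rn n"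
  by (auto simp: Rn_def)

section \<open>Gradients of least-squares functions\<close>

text \<open>
  Gradients within a subspace are unique: restricting to the line through \<open>x\<close> in the direction
  \<open>v - w\<close>, which stays in the subspace, gives \<open>inner v (v - w) = inner w (v - w)\<close>.
\<close>

lemma has_grad_unique:
  assumes "x \<in> Rn n" "has_grad n h x v" "has_grad n h x w"
  shows "v = w"
proof -
  define d where "d = v - w"
  have d: "d \<in> Rn n"
    using assms by (simp add: d_def has_grad_def subspace_diff)
  have line: "((\<lambda>s. h (x + s *\<^sub>R d)) has_derivative (\<lambda>s. inner z (s *\<^sub>R d))) (at 0)"
    if z: "has_grad n h x z" for z
  proof (rule has_derivative_in_compose[where f = "\<lambda>s. x + s *\<^sub>R d" and g' = "inner z"])
    show "((\<lambda>s. x + s *\<^sub>R d) has_derivative (\<lambda>s. s *\<^sub>R d)) (at 0)"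
      by (auto intro!: derivative_eq_intros)
    show "(h has_derivative inner z) (at (x + 0 *\<^sub>R d) within range (\<lambda>s. x + s *\<^sub>R d))"
      using z d \<open>x \<in> Rn n\<close> unfolding has_grad_def
      by (auto intro!: has_derivative_subset[of h _ x "Rn n"] subspace_add subspace_scale)
  qed
  have "(\<lambda>s. inner v (s *\<^sub>R d)) = (\<lambda>s. inner w (s *\<^sub>R d))"
    using has_derivative_unique[OF line line] assms by blast
  from fun_cong[OF this, of 1] have "inner (v - w) (v - w) = 0"
    by (simp add: d_def inner_diff_left)
  then show ?thesis by simp
qed

lemma grad_eqI: "x \<in> Rn n \<Longrightarrow> has_grad n h x v \<Longrightarrow> grad n h x = v"
  unfolding grad_def using has_grad_unique by blast

definition lsq :: "(nat \<Rightarrow> fvec) \<Rightarrow> (nat \<Rightarrow> real) \<Rightarrow> nat \<Rightarrow> fvec \<Rightarrow> real"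
  where "lsq v \<beta> N x = (\<Sum>i<N. (inner (v i) x - \<beta> i)\<^sup>2)"

lemma has_grad_lsq:
  assumes "\<And>i. i < N \<Longrightarrow> v i \<in> Rn n"
  shows "has_grad n (\<lambda>x. a * lsq v \<beta> N x) x
    ((2 * a) *\<^sub>R (\<Sum>i<N. (inner (v i) x - \<beta> i) *\<^sub>R v i))"
  unfolding has_grad_def
proof
  show "(2 * a) *\<^sub>R (\<Sum>i<N. (inner (v i) x - \<beta> i) *\<^sub>R v i) \<in> Rn n"
    using assms by (intro subspace_scale subspace_sum) auto
  show "((\<lambda>x. a * lsq v \<beta> N x) has_derivative
      inner ((2 * a) *\<^sub>R (\<Sum>i<N. (inner (v i) x - \<beta> i) *\<^sub>R v i))) (at x within Rn n)"
    unfolding lsq_def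
    by (rule has_derivative_eq_rhs, (rule derivative_intros)+)
       (auto simp: fun_eq_iff inner_sum_left sum_distrib_left intro!: sum.cong)
qed

lemma grad_lsq:
  assumes "\<And>i. i < N \<Longrightarrow> v i \<in> Rn n" "x \<in> Rn n"
  shows "grad n (\<lambda>x. a * lsq v \<beta> N x) x =
    (2 * a) *\<^sub>R (\<Sum>i<N. (inner (v i) x - \<beta> i) *\<^sub>R v i)"
  using assms by (intro grad_eqI has_grad_lsq)

lemma grad_zero: "x \<in> Rn n \<Longrightarrow> grad n (\<lambda>_. 0) x = 0"
  by (rule grad_eqI) (auto simp: has_grad_def Rn_def)

text \<open>
  If \<open>T\<close> maps \<open>d\<close> to the vector of the numbers \<open>inner (v i) d\<close>, the difference of two gradients is
  \<open>2 * a\<close> times \<open>T\<^sup>* (T d)\<close>, and the hypothesis bounds the squared operator norm of \<open>T\<close> by \<open>K\<close>.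
\<close>

lemma grad_lsq_lipschitz:
  assumes v: "\<And>i. i < N \<Longrightarrow> v i \<in> Rn n" and "0 \<le> a" "0 \<le> K"
    and bessel: "\<And>d. (\<Sum>i<N. (inner (v i) d)\<^sup>2) \<le> K * (norm d)\<^sup>2"
  shows "(2 * a * K)-lipschitz_on (Rn n) (grad n (\<lambda>x. a * lsq v \<beta> N x))"
proof (rule lipschitz_onI)
  fix x y assume xy: "x \<in> Rn n" "y \<in> Rn n"
  define d where "d = x - y"
  define w where "w = (\<Sum>i<N. inner (v i) d *\<^sub>R v i)"
  have diff: "grad n (\<lambda>x. a * lsq v \<beta> N x) x - grad n (\<lambda>x. a * lsq v \<beta> N x) y = (2 * a) *\<^sub>R w"
    using xy v by (simp add: grad_lsq w_def d_def scaleR_diff_right[symmetric]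
        sum_subtractf[symmetric] scaleR_diff_left[symmetric] inner_diff_right)
  have "((norm w)\<^sup>2)\<^sup>2 = (\<Sum>i<N. inner (v i) d * inner (v i) w)\<^sup>2"
    by (subst power2_norm_eq_inner, subst (1) w_def) (simp add: inner_sum_left)
  also have "\<dots> \<le> (\<Sum>i<N. (inner (v i) d)\<^sup>2) * (\<Sum>i<N. (inner (v i) w)\<^sup>2)"
    by (rule Cauchy_Schwarz_ineq_sum)
  also have "\<dots> \<le> (K * (norm d)\<^sup>2) * (K * (norm w)\<^sup>2)"
    using \<open>0 \<le> K\<close> by (intro mult_mono bessel) (auto intro: sum_nonneg)
  finally have "((norm w)\<^sup>2)\<^sup>2 \<le> (K * norm d * norm w)\<^sup>2"
    by (simp add: power_mult_distrib power2_eq_square mult_ac)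
  then have "norm w * norm w \<le> K * norm d * norm w"
    using \<open>0 \<le> K\<close> power2_le_imp_le[of "(norm w)\<^sup>2" "K * norm d * norm w"]
    by (simp add: power2_eq_square[of "norm w"])
  then have "norm w \<le> K * norm d"
    using \<open>0 \<le> K\<close> by (cases "w = 0") auto
  then have "2 * a * norm w \<le> 2 * a * (K * norm d)"
    using \<open>0 \<le> a\<close> by (intro mult_left_mono) auto
  then show "dist (grad n (\<lambda>x. a * lsq v \<beta> N x) x) (grad n (\<lambda>x. a * lsq v \<beta> N x) y)
      \<le> 2 * a * K * dist x y"
    using \<open>0 \<le> a\<close> by (simp add: dist_norm diff d_def mult_ac)
qed (use assms in auto)

lemma convex_on_lsq: "convex_on (Rn n) (lsq v \<beta> N)"
proof (rule convex_onI)
  fix t :: real and x y assume t: "0 < t" "t < 1"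
  have "(inner (v i) ((1 - t) *\<^sub>R x + t *\<^sub>R y) - \<beta> i)\<^sup>2
      \<le> (1 - t) * (inner (v i) x - \<beta> i)\<^sup>2 + t * (inner (v i) y - \<beta> i)\<^sup>2" for i
    using convex_onD[OF convex_power2, of t "inner (v i) x - \<beta> i" "inner (v i) y - \<beta> i"] t
    by (simp add: algebra_simps)
  then show "lsq v \<beta> N ((1 - t) *\<^sub>R x + t *\<^sub>R y) \<le> (1 - t) * lsq v \<beta> N x + t * lsq v \<beta> N y"
    unfolding lsq_def sum_distrib_left sum.distrib[symmetric] by (intro sum_mono)
qed simp

lemma smooth_convex_lsq:
  assumes "\<And>i. i < N \<Longrightarrow> v i \<in> Rn n" "0 \<le> a" "0 \<le> K"
    and "\<And>d. (\<Sum>i<N. (inner (v i) d)\<^sup>2) \<le> K * (norm d)\<^sup>2"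
  shows "smooth_convex n (\<lambda>x. a * lsq v \<beta> N x)"
  unfolding smooth_convex_def
proof (intro conjI ballI)
  show "convex_on (Rn n) (\<lambda>x. a * lsq v \<beta> N x)"
    using assms(2) convex_on_lsq by (rule convex_on_cmul)
  show "\<exists>w. has_grad n (\<lambda>x. a * lsq v \<beta> N x) x w" for x
    by (rule exI, rule has_grad_lsq) (rule assms(1))
  show "\<exists>L. L-lipschitz_on (Rn n) (grad n (\<lambda>x. a * lsq v \<beta> N x))"
    using grad_lsq_lipschitz[of N v n a K] assms by blast
qed

lemma smooth_convex_zero: "smooth_convex n (\<lambda>_. 0)"
  using smooth_convex_lsq[of 0 _ n 0 0] by simp

section \<open>Nesterov's chain\<close>

fun edge :: "nat \<Rightarrow> fvec" where
  "edge 0 = unit 0"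
| "edge (Suc i) = unit (Suc i) - unit i"

abbreviation chain :: "real \<Rightarrow> nat \<Rightarrow> fvec \<Rightarrow> real"
  where "chain b \<equiv> lsq edge (\<lambda>i. if i = 0 then b else 0)"

lemma edge_in_Rn: "i < n \<Longrightarrow> edge i \<in> Rn n"
  by (cases i) (auto simp: Rn_def)

lemma inner_edge_Suc [simp]: "inner (edge (Suc i)) x = coord x (Suc i) - coord x i"
  by (simp add: inner_diff_left)

declare edge.simps(2) [simp del]

text \<open>Each coordinate occurs in at most two increments, and \<open>(p - q)\<^sup>2 \<le> 2 * p\<^sup>2 + 2 * q\<^sup>2\<close>.\<close>

lemma chain_edges_bessel: "(\<Sum>i<N. (inner (edge i) d)\<^sup>2) \<le> 4 * (norm d)\<^sup>2"
proof (cases N)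
  case (Suc m)
  have square_bound: "(p - q)\<^sup>2 \<le> 2 * p\<^sup>2 + 2 * q\<^sup>2" for p q :: real
    using zero_le_power2[of "p + q"] by (simp add: power2_eq_square algebra_simps)
  have "(\<Sum>i<N. (inner (edge i) d)\<^sup>2)
      = (coord d 0)\<^sup>2 + (\<Sum>i<m. (coord d (Suc i) - coord d i)\<^sup>2)"
    by (simp add: Suc sum.lessThan_Suc_shift del: sum.lessThan_Suc)
  also have "\<dots> \<le> 2 * (coord d 0)\<^sup>2 + (\<Sum>i<m. 2 * (coord d (Suc i))\<^sup>2 + 2 * (coord d i)\<^sup>2)"
    by (intro add_mono sum_mono) (simp, use square_bound in blast)
  also have "\<dots> = 2 * (\<Sum>i<Suc m. (coord d i)\<^sup>2) + 2 * (\<Sum>i<m. (coord d i)\<^sup>2)"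
    by (simp add: sum.lessThan_Suc_shift sum.distrib sum_distrib_left del: sum.lessThan_Suc)
  also have "\<dots> \<le> 4 * (norm d)\<^sup>2"
    using sum_coord_le_norm[of d m] sum_coord_le_norm[of d "Suc m"] by linarith
  finally show ?thesis .
qed simp

text \<open>
  The residuals telescope: up to index \<open>m\<close> they add up to \<open>coord x m - b\<close>. Among \<open>m + 1\<close> numbers
  with sum \<open>- b\<close>, equal ones have the least sum of squares.
\<close>

lemma chain_lower_bound:
  assumes "coord x m = 0"
  shows "b\<^sup>2 / real (Suc m) \<le> chain b (Suc m) x"
proof -
  have tele: "(\<Sum>i<Suc k. inner (edge i) x - (if i = 0 then b else 0)) = coord x k - b" for k
    by (induction k) auto
  have "b\<^sup>2 = (\<Sum>i<Suc m. inner (edge i) x - (if i = 0 then b else 0))\<^sup>2"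
    unfolding tele using assms by simp
  also have "\<dots> \<le> chain b (Suc m) x * real (Suc m)"
    unfolding lsq_def
    using sum_squared_le_sum_of_squares[of "\<lambda>i. inner (edge i) x - (if i = 0 then b else 0)" "{..<Suc m}"]
    by (simp only: card_lessThan)
  finally show ?thesis by (simp add: field_simps)
qed

definition plateau :: "real \<Rightarrow> nat \<Rightarrow> fvec"
  where "plateau b N = (\<Sum>i<N. b *\<^sub>R unit i)"

lemma coord_plateau [simp]: "coord (plateau b N) i = (if i < N then b else 0)"
  by (simp add: plateau_def if_distrib cong: if_cong)

lemma plateau_in_Rn: "N \<le> n \<Longrightarrow> plateau b N \<in> Rn n"
  by (simp add: Rn_def)

lemma norm_plateau: "norm (plateau b N) = sqrt (real N) * \<bar>b\<bar>"
  by (simp add: norm_Rn[OF plateau_in_Rn[OF order_refl]] L2_set_def real_sqrt_mult)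

lemma inner_edge_plateau:
  "i < N \<Longrightarrow> inner (edge i) (plateau b N) = (if i = 0 then b else 0)"
  by (cases i) auto

lemma chain_plateau: "chain b N (plateau b N) = 0"
  by (simp add: lsq_def inner_edge_plateau)

text \<open>
  Only the edges meeting the support of \<open>y\<close> have a nonzero residual, apart from the first one,
  whose target is \<open>b\<close>; the last of these edges reaches one coordinate beyond the support.
\<close>

lemma grad_chain_support:
  assumes "N \<le> n" "y \<in> Rn n" "y \<in> Rn t"
  shows "grad n (\<lambda>x. a * chain b N x) y \<in> Rn (Suc t)"
proof -
  have "(inner (edge i) y - (if i = 0 then b else 0)) *\<^sub>R edge i \<in> Rn (Suc t)" for i
  proof (cases "i < Suc t")
    case True
    then show ?thesis by (intro subspace_scale edge_in_Rn) auto
  next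
    case False
    then obtain j where "i = Suc j" "t \<le> j" by (cases i) auto
    with assms(3) have "inner (edge i) y - (if i = 0 then b else 0) = 0"
      by (simp add: Rn_def)
    then show ?thesis by (simp add: subspace_0)
  qed
  then have "(2 * a) *\<^sub>R (\<Sum>i<N. (inner (edge i) y - (if i = 0 then b else 0)) *\<^sub>R edge i)
      \<in> Rn (Suc t)"
    by (rule subspace_scale[OF subspace_Rn subspace_sum[OF subspace_Rn]])
  then show ?thesis
    using assms by (subst grad_lsq) (auto intro: edge_in_Rn)
qed

section \<open>The hard problem\<close>

definition chain_problem :: "real \<Rightarrow> real \<Rightarrow> nat \<Rightarrow> problem"
  where "chain_problem a b N =
    \<lparr>num = 2, alpha = 0, radius = \<infinity>, obj = (\<lambda>_. 0),
     con = (\<lambda>i. if i = 0 then (\<lambda>_. 0) else (\<lambda>x. a * chain b N x))\<rparr>"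

lemma chain_problem_simps [simp]:
  "num (chain_problem a b N) = 2" "alpha (chain_problem a b N) = 0"
  "radius (chain_problem a b N) = \<infinity>" "obj (chain_problem a b N) = (\<lambda>_. 0)"
  "con (chain_problem a b N) 0 = (\<lambda>_. 0)"
  "con (chain_problem a b N) (Suc 0) = (\<lambda>x. a * chain b N x)"
  "total_obj (chain_problem a b N) = (\<lambda>_. 0)"
  "domain n (chain_problem a b N) = Rn n"
  by (auto simp: chain_problem_def total_obj_def domain_def fun_eq_iff)

lemma lessThan_two: "{..<2::nat} = {0, Suc 0}"
  by auto

lemma all_less_two: "(\<forall>i<2. Q i) \<longleftrightarrow> Q 0 \<and> Q (Suc 0)"
  by (auto simp: less_2_cases_iff)

lemma problem_chain_problem: "N \<le> n \<Longrightarrow> 0 \<le> a \<Longrightarrow> problem n (chain_problem a b N)"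
  by (auto simp: problem_def all_less_two smooth_convex_zero
      intro!: smooth_convex_lsq[where K = 4] edge_in_Rn chain_edges_bessel)

lemma optimal_solution_chain_problem:
  "N \<le> n \<Longrightarrow> optimal_solution n (chain_problem a b N) (plateau b N)"
  by (simp add: optimal_solution_def all_less_two plateau_in_Rn chain_plateau)

lemma kkt_multiplier_chain_problem:
  assumes "N \<le> n" "0 \<le> l"
  shows "kkt_multiplier n (chain_problem a b N) (plateau b N) (l *\<^sub>R unit 0)"
  using assms
  by (simp add: kkt_multiplier_def all_less_two lessThan_two grad_zero plateau_in_Rn)
     (simp add: Rn_def)

text \<open>
  The multipliers in question have second entry between \<open>0\<close> and \<open>c\<close>, and the first entry multiplies
  the zero function.
\<close>

lemma aggregate_smoothness_chain_problem:
  assumes "N \<le> n" "0 \<le> a" "0 \<le> c"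
  shows "aggregate_smoothness n (chain_problem a b N)
    (multiplier_set (chain_problem a b N) (l *\<^sub>R unit 0) c) \<le> ereal (8 * a * c)"
  unfolding aggregate_smoothness_def
proof (rule SUP_least)
  fix \<mu> assume "\<mu> \<in> multiplier_set (chain_problem a b N) (l *\<^sub>R unit 0) c"
  then have \<mu>: "0 \<le> coord \<mu> (Suc 0)" "coord \<mu> (Suc 0) \<le> c"
    using \<open>0 \<le> c\<close>
    by (auto simp: multiplier_set_def all_less_two
        intro: order_trans[OF abs_le_D1[OF abs_coord_le_norm]])
  let ?k = "coord \<mu> (Suc 0) * a"
  have lip: "(2 * ?k * 4)-lipschitz_on (Rn n) (grad n (\<lambda>x. ?k * chain b N x))"
    using assms \<mu> by (intro grad_lsq_lipschitz chain_edges_bessel edge_in_Rn) auto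
  have "?k \<le> c * a"
    using \<mu> assms by (intro mult_right_mono)
  then have "(8 * a * c)-lipschitz_on (Rn n) (grad n (\<lambda>x. ?k * chain b N x))"
    by (intro lipschitz_on_le[OF lip]) (simp add: mult_ac)
  then show "grad_lipschitz n (\<lambda>x. obj (chain_problem a b N) x +
      (\<Sum>i<num (chain_problem a b N). coord \<mu> i * con (chain_problem a b N) i x))
      \<le> ereal (8 * a * c)"
    unfolding grad_lipschitz_def
    by (intro Inf_lower) (auto simp: lessThan_two mult.assoc)
qed

lemma chain_run_support:
  assumes run: "first_order_run n (chain_problem a b N) 0 M" and "N \<le> n" "t \<le> n"
  shows "M t \<subseteq> Rn t"
  using \<open>t \<le> n\<close>
proof (induction t)
  case 0
  then show ?case using run by (simp add: first_order_run_def Rn_def)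
next
  case (Suc t)
  then have span: "span (M t) \<subseteq> Rn t"
    by (intro span_minimal) auto
  show ?case
  proof
    fix z assume "z \<in> M (Suc t)"
    then have "z \<in> {x + \<eta> *\<^sub>R grad n (\<lambda>_. 0) y
          + (\<Sum>i<2. \<tau> i *\<^sub>R grad n (con (chain_problem a b N) i) y) | x y \<eta> \<tau>.
        x \<in> span (M t) \<and> y \<in> span (M t)}"
      using run unfolding first_order_run_def chain_problem_simps by (meson subsetD)
    then obtain x y \<eta> \<tau> where x: "x \<in> span (M t)" and y: "y \<in> span (M t)"
      and z: "z = x + \<eta> *\<^sub>R grad n (\<lambda>_. 0) y + (\<Sum>i<2. \<tau> i *\<^sub>R grad n (con (chain_problem a b N) i) y)"
      by blast
    have y': "y \<in> Rn n" "y \<in> Rn t"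
      using y span Rn_mono[of t n] Suc.prems by auto
    have "z = x + \<tau> (Suc 0) *\<^sub>R grad n (\<lambda>x. a * chain b N x) y"
      using y' by (simp add: z lessThan_two grad_zero)
    moreover have "x \<in> Rn (Suc t)"
      using x span Rn_mono[of t "Suc t"] by auto
    ultimately show "z \<in> Rn (Suc t)"
      using y' \<open>N \<le> n\<close>
      by (simp add: subspace_add[OF subspace_Rn] subspace_scale[OF subspace_Rn] grad_chain_support)
  qed
qed

lemma chain_run_slow:
  assumes run: "first_order_run n (chain_problem a b N) 0 M" and N: "0 < N" "N \<le> n"
    and "0 \<le> a" and gap: "d < a * (b\<^sup>2 / real N)"
    and x: "x \<in> M t" "approx_optimal (chain_problem a b N) xs e d x"
  shows "N \<le> t"
proof (rule ccontr)
  assume "\<not> N \<le> t"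
  then have "x \<in> Rn (N - 1)"
    using chain_run_support[OF run N(2), of t] N x Rn_mono[of t "N - 1"] by force
  then have "coord x (N - 1) = 0" by (simp add: Rn_def)
  then have "b\<^sup>2 / real N \<le> chain b N x"
    using chain_lower_bound[of x "N - 1" b] N by simp
  then have "d < a * chain b N x"
    using gap mult_left_mono[of "b\<^sup>2 / real N" "chain b N x" a] \<open>0 \<le> a\<close> by linarith
  also have "\<dots> \<le> max 0 (con (chain_problem a b N) (Suc 0) x)"
    by simp
  also have "\<dots> \<le> L2_set (\<lambda>i. max 0 (con (chain_problem a b N) i x)) {..<2}"
    by (rule member_le_L2_set) auto
  also have "\<dots> \<le> d"
    using x by (simp add: approx_optimal_def)
  finally show False by simp
qed

theorem theorem4:
  shows "\<exists>C>0. \<forall>(L :: real) (R0 :: real) (l :: real) (c :: real) (\<epsilon> :: real) (n :: nat).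
    0 < L \<and> 1 \<le> R0 \<and> 1 \<le> l \<and> 1 \<le> c \<and> 0 < \<epsilon> \<and> \<epsilon> \<le> L * R0\<^sup>2 / 100 \<and>
    int n > 2 * \<lceil>R0 * sqrt (L / \<epsilon>)\<rceil> \<longrightarrow>
    (\<exists>P x0 xs ls.
       problem n P \<and> alpha P = 0 \<and> affine_fun n (obj P) \<and>
       optimal_solution n P xs \<and> kkt_multiplier n P xs ls \<and> norm ls = l \<and>
       x0 \<in> domain n P \<and> norm (x0 - xs) \<le> R0 \<and>
       aggregate_smoothness n P (multiplier_set P ls c) \<le> ereal L \<and>
       (\<forall>M t. first_order_run n P x0 M \<and> (\<exists>x\<in>M t. approx_optimal P xs \<epsilon> (\<epsilon> / c) x) \<longrightarrow>
          C * (sqrt L * R0 / sqrt \<epsilon>) \<le> real t))"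
proof (intro exI[of _ "1/5"] conjI allI impI)
  fix L R0 l c \<epsilon> :: real and n :: nat
  assume "0 < L \<and> 1 \<le> R0 \<and> 1 \<le> l \<and> 1 \<le> c \<and> 0 < \<epsilon> \<and> \<epsilon> \<le> L * R0\<^sup>2 / 100 \<and>
    int n > 2 * \<lceil>R0 * sqrt (L / \<epsilon>)\<rceil>"
  then have L: "0 < L" and R0: "1 \<le> R0" and l: "1 \<le> l" and c: "1 \<le> c" and \<epsilon>: "0 < \<epsilon>"
    and small: "\<epsilon> \<le> L * R0\<^sup>2 / 100" and n: "int n > 2 * \<lceil>R0 * sqrt (L / \<epsilon>)\<rceil>"
    by auto
  define r where "r = R0 * sqrt (L / \<epsilon>)"
  have r_sq: "r\<^sup>2 = R0\<^sup>2 * L / \<epsilon>"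
    using L \<epsilon> by (simp add: r_def power_mult_distrib)
  have "10\<^sup>2 \<le> r\<^sup>2"
    using small \<epsilon> by (simp add: r_sq field_simps)
  then have r10: "10 \<le> r"
    by (rule power2_le_imp_le) (use R0 L \<epsilon> in \<open>auto simp: r_def\<close>)
  \<comment> \<open>The violation exceeds \<open>\<epsilon> / c\<close> as soon as \<open>8 * N\<^sup>2 < r\<^sup>2\<close>, so \<open>N\<close> is the largest integer
    below \<open>r / 3\<close>. As \<open>10 \<le> r\<close>, the rounding leaves at least \<open>r / 5\<close>.\<close>
  define N where "N = nat (\<lceil>r / 3\<rceil> - 1)"
  have ceil: "r / 3 \<le> of_int \<lceil>r / 3\<rceil>" "of_int \<lceil>r / 3\<rceil> < r / 3 + 1"
    by linarith+
  then have "1 < \<lceil>r / 3\<rceil>"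
    using r10 by linarith
  then have N_eq: "real N = of_int \<lceil>r / 3\<rceil> - 1"
    by (simp add: N_def)
  have N_less: "real N < r / 3" and N_ge: "r / 5 \<le> real N" and N_pos: "0 < N"
    using ceil r10 N_eq by (linarith, linarith, simp add: N_def)
  have "r \<le> of_int \<lceil>r\<rceil>" "2 * of_int \<lceil>r\<rceil> < real n"
    using n unfolding r_def[symmetric] by linarith+
  then have N_le: "N \<le> n"
    using N_less r10 by linarith
  define b where "b = R0 / sqrt (real N)"
  define a where "a = L / (8 * c)"
  let ?P = "chain_problem a b N"
  have a: "0 \<le> a"
    using L c by (simp add: a_def)
  have gap: "\<epsilon> / c < a * (b\<^sup>2 / real N)"
  proof -
    have "8 * (real N)\<^sup>2 \<le> 9 * (real N)\<^sup>2" by simp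
    also have "9 * (real N)\<^sup>2 = (3 * real N)\<^sup>2" by (simp add: power_mult_distrib)
    also have "\<dots> < r\<^sup>2"
      using N_less by (intro power_strict_mono) auto
    finally have "8 * (real N)\<^sup>2 * \<epsilon> < R0\<^sup>2 * L"
      using \<epsilon> by (simp add: r_sq field_simps)
    then show ?thesis
      using c N_pos by (simp add: a_def b_def field_simps power2_eq_square)
  qed
  show "\<exists>P x0 xs ls.
       problem n P \<and> alpha P = 0 \<and> affine_fun n (obj P) \<and>
       optimal_solution n P xs \<and> kkt_multiplier n P xs ls \<and> norm ls = l \<and>
       x0 \<in> domain n P \<and> norm (x0 - xs) \<le> R0 \<and>
       aggregate_smoothness n P (multiplier_set P ls c) \<le> ereal L \<and>
       (\<forall>M t. first_order_run n P x0 M \<and> (\<exists>x\<in>M t. approx_optimal P xs \<epsilon> (\<epsilon> / c) x) \<longrightarrow>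
          1 / 5 * (sqrt L * R0 / sqrt \<epsilon>) \<le> real t)"
  proof (rule exI[of _ ?P], rule exI[of _ 0], rule exI[of _ "plateau b N"],
      rule exI[of _ "l *\<^sub>R unit 0"], intro conjI allI impI)
    show "problem n ?P"
      using N_le a by (rule problem_chain_problem)
    show "affine_fun n (obj ?P)"
      by (auto simp: affine_fun_def Rn_def intro!: bexI[of _ 0] exI[of _ 0])
    show "optimal_solution n ?P (plateau b N)"
      using N_le by (rule optimal_solution_chain_problem)
    show "kkt_multiplier n ?P (plateau b N) (l *\<^sub>R unit 0)"
      using N_le l by (intro kkt_multiplier_chain_problem) auto
    have "norm (unit 0) = 1"
      by (simp add: norm_eq_sqrt_inner)
    then show "norm (l *\<^sub>R unit 0) = l"
      using l by simp
    show "norm (0 - plateau b N) \<le> R0"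
      using N_pos R0 by (simp add: norm_plateau b_def)
    have "8 * a * c = L"
      using c by (simp add: a_def)
    then show "aggregate_smoothness n ?P (multiplier_set ?P (l *\<^sub>R unit 0) c) \<le> ereal L"
      using aggregate_smoothness_chain_problem[OF N_le a, of c b l] c by simp
    fix M t
    assume "first_order_run n ?P 0 M \<and>
      (\<exists>x\<in>M t. approx_optimal ?P (plateau b N) \<epsilon> (\<epsilon> / c) x)"
    then have "N \<le> t"
      using chain_run_slow[OF _ N_pos N_le a gap] by blast
    then have "r / 5 \<le> real t"
      using N_ge by linarith
    then show "1 / 5 * (sqrt L * R0 / sqrt \<epsilon>) \<le> real t"
      by (simp add: r_def real_sqrt_divide mult_ac)
  qed (auto simp: Rn_def)
qed simp

end
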